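(* There exist two norms $\|\cdot\|$ and $|||\cdot|||$ on $\mathbb{R}^3$, where $\|\cdot\|$ is a $C^\infty$-norm, such that for the unit sphere $M=\{x\in\mathbb{R}^3:\|x\|=1\}$, considered as a subset of $(\mathbb{R}^3,|||\cdot|||)$, the following condition does not hold: for every $\xi>0$ there exist a set $\hat M\subseteq\mathbb{R}^3$ with $M\subseteq\operatorname{int}(\hat M)$ and a Lipschitz map $\Psi\colon\hat M\to M$ such that $\operatorname{Lip}(\Psi)\le 1+\xi$ and $|||\Psi(x)-x|||\le\xi$ for all $x\in\hat M$.
   Context: $\operatorname{int}$ denotes topological interior in $\mathbb{R}^3$. The Lipschitz constant is taken with respect to $|||\cdot|||$ in both domain and target: $\operatorname{Lip}(\Psi)=\sup\{|||\Psi(x)-\Psi(y)|||/|||x-y|||: x,y\in\hat M,\ x\neq y\}$. A norm is called a $C^\infty$-norm if it is infinitely differentiable on $\mathbb{R}^3\setminus\{0\}$. *)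

theory Defs
  imports "HOL-Analysis.Analysis"
begin

definition is_norm :: "('a::real_vector \<Rightarrow> real) \<Rightarrow> bool" where
  "is_norm N \<longleftrightarrow>
     (\<forall>x. 0 \<le> N x) \<and>
     (\<forall>x. N x = 0 \<longleftrightarrow> x = 0) \<and>
     (\<forall>c x. N (c *\<^sub>R x) = \<bar>c\<bar> * N x) \<and>
     (\<forall>x y. N (x + y) \<le> N x + N y)"

(* Class C^k on an open set S: directional derivatives exist up to order k (as values of
   Frechet derivatives) and are continuous. "frechet_derivative f (at x)" is a choice of the
   derivative, which is unique wherever it exists; differentiability is demanded separately. *)
fun C_k_on :: "nat \<Rightarrow> ('a::euclidean_space \<Rightarrow> real) \<Rightarrow> 'a set \<Rightarrow> bool" where
  "C_k_on 0 f S \<longleftrightarrow> continuous_on S f"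
| "C_k_on (Suc k) f S \<longleftrightarrow>
     (\<forall>x\<in>S. f differentiable (at x)) \<and>
     (\<forall>v. C_k_on k (\<lambda>x. frechet_derivative f (at x) v) S)"

definition is_smooth_norm :: "('a::euclidean_space \<Rightarrow> real) \<Rightarrow> bool" where
  "is_smooth_norm N \<longleftrightarrow> is_norm N \<and> (\<forall>k. C_k_on k N (UNIV - {0}))"

definition lipschitz_wrt ::
    "('a::real_vector \<Rightarrow> real) \<Rightarrow> 'a set \<Rightarrow> ('a \<Rightarrow> 'a) \<Rightarrow> bool" where
  "lipschitz_wrt N S f \<longleftrightarrow>
     (\<exists>L\<ge>0. \<forall>x\<in>S. \<forall>y\<in>S. N (f x - f y) \<le> L * N (x - y))"

(* A supremum in the reals: meaningful only if "lipschitz_wrt N S f" holds (the set is then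
   bounded above) and S has at least two points. *)
definition Lip_wrt ::
    "('a::real_vector \<Rightarrow> real) \<Rightarrow> 'a set \<Rightarrow> ('a \<Rightarrow> 'a) \<Rightarrow> real" where
  "Lip_wrt N S f = Sup {N (f x - f y) / N (x - y) | x y. x \<in> S \<and> y \<in> S \<and> x \<noteq> y}"

end

theory Submission
  imports Defs
begin

text \<open>
  The norm \<open>hex_norm\<close> is the supremum norm in the linear coordinates \<open>x + z\<close>, \<open>y + z\<close>, \<open>z - x - y\<close>. No linear
  projection onto the plane \<open>z = 0\<close> has norm one: the vectors \<open>(4, -2, -1)\<close>, \<open>(-2, 4, -1)\<close>, \<open>(-2, -2, -1)\<close>
  have norm \<open>3\<close>, and if \<open>w\<close> were the image of \<open>(0, 0, 1)\<close>, then comparing the \<open>k\<close>-th coordinate of the image of the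
  \<open>k\<close>-th vector with \<open>3\<close> would force every coordinate of \<open>w\<close> to be at least \<open>4 - 3 = 1\<close>; but the
  three coordinates of a vector of the plane add up to \<open>0\<close>.

  The smooth norm \<open>capped_norm\<close> is chosen such that its unit sphere contains a disc of the plane
  \<open>z = 1\<close> (\<open>capped_norm_cap\<close>, \<open>is_smooth_norm_capped_norm\<close>). A map \<open>\<Psi>\<close> as in the theorem, with small \<open>\<xi>\<close>, sends
  a neighbourhood of a smaller disc into that plane, and it should behave like a projection of norm
  almost one. It need not be differentiable, it need not fix the disc, and its domain may be much
  thinner than \<open>\<xi>\<close>, so the derivative is replaced by difference quotients averaged over a grid
  in the disc. Horizontal increments telescope over the grid, and so closeness to the identity
  determines their average (\<open>grid_sum_bound\<close>); vertical increments cancel in the sum of the three coordinates.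
  The computation for linear projections then carries over to averages and gives a contradiction
  already for \<open>\<xi> = 1/100\<close> (\<open>no_almost_nonexpansive_retraction\<close>).

  Smoothness of the norm is reduced to closure properties of the classes \<open>C_k_on\<close> and to the
  function \<open>exp (-1/x)\<close>.
\<close>

section \<open>Calculus of the classes of k times continuously differentiable functions\<close>

text \<open>
  The recursive equation quantifies over all directions. It is kept out of rewriting in favour of
  the rules below, which apply it to one direction at a time.
\<close>

declare C_k_on.simps(2) [simp del]

lemma C_k_on_SucD:
  assumes "C_k_on (Suc k) f S"
  shows C_k_on_has_derivative: "x \<in> S \<Longrightarrow> (f has_derivative frechet_derivative f (at x)) (at x)"
    and C_k_on_frechet_derivative: "C_k_on k (\<lambda>x. frechet_derivative f (at x) v) S"
  using assms unfolding C_k_on.simps(2) frechet_derivative_works by blast+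

lemma C_k_onI:
  assumes "\<And>x. x \<in> S \<Longrightarrow> (f has_derivative frechet_derivative f (at x)) (at x)"
    and "\<And>v. C_k_on k (\<lambda>x. frechet_derivative f (at x) v) S"
  shows "C_k_on (Suc k) f S"
  unfolding C_k_on.simps(2) frechet_derivative_works using assms by blast

lemma C_k_on_cong:
  assumes "open S" "C_k_on k f S" "\<And>x. x \<in> S \<Longrightarrow> f x = g x"
  shows "C_k_on k g S"
  using assms(2,3)
proof (induction k arbitrary: f g)
  case 0
  then show ?case by (simp cong: continuous_on_cong)
next
  case (Suc k)
  have g: "(g has_derivative frechet_derivative f (at x)) (at x)" if "x \<in> S" for x
    by (rule has_derivative_transform_within_open[OF
          C_k_on_has_derivative[OF Suc.prems(1) that] \<open>open S\<close> that Suc.prems(2)])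
  have eq: "frechet_derivative g (at x) = frechet_derivative f (at x)" if "x \<in> S" for x
    using frechet_derivative_at[OF g[OF that]] by (rule sym)
  show ?case
  proof (rule C_k_onI)
    show "(g has_derivative frechet_derivative g (at x)) (at x)" if "x \<in> S" for x
      unfolding eq[OF that] by (rule g[OF that])
    show "C_k_on k (\<lambda>x. frechet_derivative g (at x) v) S" for v
      by (rule Suc.IH[OF C_k_on_frechet_derivative[OF Suc.prems(1)]]) (simp only: eq)
  qed
qed

lemma C_k_on_has_derivativeI:
  assumes "\<And>x. x \<in> S \<Longrightarrow> (f has_derivative f' x) (at x)"
    and "\<And>v. C_k_on k (\<lambda>x. f' x v) S" and "open S"
  shows "C_k_on (Suc k) f S"
proof (rule C_k_onI)
  have eq: "frechet_derivative f (at x) = f' x" if "x \<in> S" for x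
    using frechet_derivative_at[OF assms(1)[OF that]] by (rule sym)
  show "(f has_derivative frechet_derivative f (at x)) (at x)" if "x \<in> S" for x
    unfolding eq[OF that] by (rule assms(1)[OF that])
  show "C_k_on k (\<lambda>x. frechet_derivative f (at x) v) S" for v
    by (rule C_k_on_cong[OF assms(3,2)]) (simp only: eq)
qed

lemma C_k_on_pred: "C_k_on (Suc k) f S \<Longrightarrow> C_k_on k f S"
proof (induction k arbitrary: f)
  case 0
  then have "isCont f x" if "x \<in> S" for x
    using that C_k_on_has_derivative has_derivative_continuous by blast
  then show ?case
    by (simp add: continuous_at_imp_continuous_on)
next
  case (Suc k)
  show ?case
    by (rule C_k_onI[OF C_k_on_has_derivative[OF Suc.prems]
          Suc.IH[OF C_k_on_frechet_derivative[OF Suc.prems]]])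
qed

lemma C_k_on_Un:
  assumes "open S" "open U" "C_k_on k f S" "C_k_on k f U"
  shows "C_k_on k f (S \<union> U)"
  using assms(3,4)
proof (induction k arbitrary: f)
  case 0
  with assms(1,2) show ?case by (simp add: continuous_on_open_Un)
next
  case (Suc k)
  show ?case
  proof (rule C_k_onI)
    show "(f has_derivative frechet_derivative f (at x)) (at x)" if "x \<in> S \<union> U" for x
      using that Suc.prems[THEN C_k_on_has_derivative] by blast
    show "C_k_on k (\<lambda>x. frechet_derivative f (at x) v) (S \<union> U)" for v
      by (rule Suc.IH[OF Suc.prems[THEN C_k_on_frechet_derivative]])
  qed
qed

lemma C_k_on_const:
  assumes "open S"
  shows "C_k_on k (\<lambda>x. c) S"
proof (induction k arbitrary: c)
  case 0
  show ?case by simp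
next
  case (Suc k)
  show ?case
  proof (rule C_k_on_has_derivativeI[where f' = "\<lambda>_ _. 0"])
    show "((\<lambda>x. c) has_derivative (\<lambda>_. 0)) (at x)" for x :: 'a
      by (rule has_derivative_const)
    show "C_k_on k (\<lambda>x. 0) S"
      by (rule Suc.IH)
  qed fact
qed

lemma C_k_on_bounded_linear:
  assumes "bounded_linear f" "open S"
  shows "C_k_on k f S"
proof (cases k)
  case 0
  then show ?thesis using assms by (simp add: linear_continuous_on)
next
  case (Suc j)
  have "C_k_on (Suc j) f S"
    by (rule C_k_on_has_derivativeI[where f' = "\<lambda>_. f"])
       (use assms in \<open>simp_all add: C_k_on_const bounded_linear_imp_has_derivative\<close>)
  then show ?thesis using Suc by simp
qed

lemma C_k_on_add:
  assumes "open S" "C_k_on k f S" "C_k_on k g S"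
  shows "C_k_on k (\<lambda>x. f x + g x) S"
  using assms(2,3)
proof (induction k arbitrary: f g)
  case 0
  then show ?case by (simp add: continuous_on_add)
next
  case (Suc k)
  note d = Suc.prems[THEN C_k_on_frechet_derivative]
  show ?case
    by (rule C_k_on_has_derivativeI[OF has_derivative_add[OF Suc.prems[THEN C_k_on_has_derivative]]
          Suc.IH[OF d] \<open>open S\<close>])
qed

text \<open>
  By the Leibniz rule the derivative of a product contains the undifferentiated factors, so the
  induction also needs the factors themselves to be of the lower class (\<open>C_k_on_pred\<close>).
\<close>

lemma C_k_on_mult:
  assumes "open S" "C_k_on k f S" "C_k_on k g S"
  shows "C_k_on k (\<lambda>x. f x * g x) S"
  using assms(2,3)
proof (induction k arbitrary: f g)
  case 0
  then show ?case by (simp add: continuous_on_mult)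
next
  case (Suc k)
  note d = Suc.prems[THEN C_k_on_frechet_derivative]
  note l = Suc.prems[THEN C_k_on_pred]
  show ?case
    by (rule C_k_on_has_derivativeI[OF has_derivative_mult[OF Suc.prems[THEN C_k_on_has_derivative]]
          C_k_on_add[OF \<open>open S\<close> Suc.IH[OF l(1) d(2)] Suc.IH[OF d(1) l(2)]] \<open>open S\<close>])
qed

lemma C_k_on_cmult: "open S \<Longrightarrow> C_k_on k f S \<Longrightarrow> C_k_on k (\<lambda>x. c * f x) S"
  by (intro C_k_on_mult C_k_on_const)

lemma C_k_on_diff:
  "open S \<Longrightarrow> C_k_on k f S \<Longrightarrow> C_k_on k g S \<Longrightarrow> C_k_on k (\<lambda>x. f x - g x) S"
  using C_k_on_add[of S k f "\<lambda>x. (-1) * g x"] C_k_on_cmult[of S k g "-1"] by simp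

lemma C_k_on_real_deriv:
  fixes f :: "real \<Rightarrow> real"
  assumes "open S" "\<And>x. x \<in> S \<Longrightarrow> (f has_real_derivative f' x) (at x)" "C_k_on k f' S"
  shows "C_k_on (Suc k) f S"
  by (rule C_k_on_has_derivativeI[OF assms(2)[unfolded has_field_derivative_def]
        C_k_on_mult[OF assms(1,3) C_k_on_const[OF assms(1)]] assms(1)])

text \<open>
  Induction along the chain rule works because a derivative of a function of one real variable
  is again such a function: in direction \<open>v\<close> the chain rule gives \<open>h' (f x)\<close> times a derivative
  of \<open>f\<close>, and the induction hypothesis applies to \<open>h'\<close> in place of \<open>h\<close>.
\<close>

lemma C_k_on_compose:
  fixes h :: "real \<Rightarrow> real"
  assumes "open S" "C_k_on k f S" "C_k_on k h U" "f ` S \<subseteq> U"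
  shows "C_k_on k (\<lambda>x. h (f x)) S"
  using assms(2,3,4)
proof (induction k arbitrary: f h)
  case 0
  then show ?case by (auto intro: continuous_on_compose2)
next
  case (Suc k)
  let ?h' = "\<lambda>y. frechet_derivative h (at y)"
  have lin: "?h' (f x) w = ?h' (f x) 1 * w" if "x \<in> S" for x w
  proof -
    have "linear (?h' (f x))"
      by (rule has_derivative_linear[OF C_k_on_has_derivative[OF Suc.prems(2)]])
         (use Suc.prems(3) that in auto)
    then have "?h' (f x) (w *\<^sub>R 1) = w *\<^sub>R ?h' (f x) 1" by (rule linear_cmul)
    then show ?thesis by simp
  qed
  show ?case
  proof (rule C_k_on_has_derivativeI)
    show "((\<lambda>x. h (f x)) has_derivative
        (\<lambda>v. ?h' (f x) (frechet_derivative f (at x) v))) (at x)" if "x \<in> S" for x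
      by (rule has_derivative_compose[OF C_k_on_has_derivative[OF Suc.prems(1) that]
            C_k_on_has_derivative[OF Suc.prems(2)]]) (use Suc.prems(3) that in auto)
    show "C_k_on k (\<lambda>x. ?h' (f x) (frechet_derivative f (at x) v)) S" for v
    proof (rule C_k_on_cong[OF \<open>open S\<close>])
      show "C_k_on k (\<lambda>x. ?h' (f x) 1 * frechet_derivative f (at x) v) S"
        by (rule C_k_on_mult[OF \<open>open S\<close> Suc.IH[OF C_k_on_pred[OF Suc.prems(1)]
                C_k_on_frechet_derivative[OF Suc.prems(2)] Suc.prems(3)]
              C_k_on_frechet_derivative[OF Suc.prems(1)]])
    qed (rule lin[symmetric])
  qed fact
qed

lemma C_k_on_powr: "C_k_on k (\<lambda>x::real. x powr a) {0<..}"
proof (induction k arbitrary: a)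
  case 0
  then show ?case by (auto intro!: continuous_intros)
next
  case (Suc k)
  show ?case
    by (rule C_k_on_real_deriv[OF _ has_real_derivative_powr C_k_on_cmult[OF _ Suc]]) auto
qed

section \<open>Flat functions\<close>

text \<open>
  The exponent \<open>n\<close> makes the family closed under differentiation, up to linear combinations;
  the member \<open>flat 0\<close> is the usual smooth function vanishing exactly on the nonpositive half line.
\<close>

definition flat :: "nat \<Rightarrow> real \<Rightarrow> real" where
  "flat n x = (if x > 0 then exp (- inverse x) * inverse x ^ n else 0)"

lemma flat_tendsto_0: "(flat n \<longlongrightarrow> 0) (at 0)"
proof (rule filterlim_split_at)
  have "((\<lambda>y::real. y ^ n / exp y) \<longlongrightarrow> 0) at_top"
    by (rule tendsto_power_div_exp_0)
  then have "((\<lambda>x::real. inverse x ^ n / exp (inverse x)) \<longlongrightarrow> 0) (at_right 0)"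
    by (rule filterlim_compose) (rule filterlim_inverse_at_top_right)
  then show "(flat n \<longlongrightarrow> 0) (at_right 0)"
    by (rule Lim_transform_eventually)
       (auto simp: eventually_at_filter flat_def exp_minus field_simps)
  show "(flat n \<longlongrightarrow> 0) (at_left 0)"
    by (rule tendsto_eventually) (auto simp: eventually_at_filter flat_def)
qed

lemma flat_has_derivative:
  "(flat n has_real_derivative flat (n + 2) x - n * flat (n + 1) x) (at x)"
proof -
  consider "x > 0" | "x < 0" | "x = 0" by linarith
  then show ?thesis
  proof cases
    case 1
    have "((\<lambda>x. exp (- inverse x) * inverse x ^ n) has_real_derivative
        flat (n + 2) x - n * flat (n + 1) x) (at x)"
    proof -
      have p: "((\<lambda>x. inverse x ^ n) has_real_derivative - (n * inverse x ^ (n + 1))) (at x)"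
      proof (rule DERIV_cong)
        show "((\<lambda>x. inverse x ^ n) has_real_derivative
            n * (- (inverse x ^ Suc (Suc 0)) * inverse x ^ (n - Suc 0))) (at x)"
          using 1 by (intro DERIV_power DERIV_inverse) simp
        show "n * (- (inverse x ^ Suc (Suc 0)) * inverse x ^ (n - Suc 0)) = - (n * inverse x ^ (n + 1))"
          by (cases n) (simp_all add: ac_simps)
      qed
      have e: "((\<lambda>x. exp (- inverse x)) has_real_derivative exp (- inverse x) * inverse x ^ 2) (at x)"
        using 1 by (auto intro!: derivative_eq_intros simp: power2_eq_square)
      show ?thesis
        using DERIV_mult[OF e p] 1 by (simp add: flat_def algebra_simps power2_eq_square)
    qed
    then show ?thesis
      by (rule has_field_derivative_transform_within_open[where S = "{0<..}"])
         (use 1 in \<open>auto simp: flat_def\<close>)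
  next
    case 2
    have "((\<lambda>x. 0) has_real_derivative flat (n + 2) x - n * flat (n + 1) x) (at x)"
      using 2 by (simp add: flat_def)
    then show ?thesis
      by (rule has_field_derivative_transform_within_open[where S = "{..<0}"])
         (use 2 in \<open>auto simp: flat_def\<close>)
  next
    case 3
    have "((\<lambda>h. (flat n (0 + h) - flat n 0) / h) \<longlongrightarrow> 0) (at 0)"
      by (rule Lim_transform_eventually[OF flat_tendsto_0[of "Suc n"]])
         (auto simp: eventually_at_filter flat_def field_simps)
    then show ?thesis using 3 by (simp add: DERIV_def flat_def)
  qed
qed

lemma C_k_on_flat: "C_k_on k (flat n) UNIV"
proof (induction k arbitrary: n)
  case 0
  then show ?case
    by (simp add: DERIV_isCont[OF flat_has_derivative] continuous_at_imp_continuous_on)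
next
  case (Suc k)
  show ?case
    by (rule C_k_on_real_deriv[OF _ flat_has_derivative])
       (auto intro!: C_k_on_diff C_k_on_cmult Suc)
qed

section \<open>A smooth convex function that is the absolute value near infinity\<close>

lemma flat_0: "flat 0 x = (if x > 0 then exp (- inverse x) else 0)"
  by (simp add: flat_def)

lemma flat_0_mono: "x \<le> y \<Longrightarrow> flat 0 x \<le> flat 0 y"
  by (auto simp: flat_0 intro: le_imp_inverse_le)

lemma flat_0_pos_iff: "0 < flat 0 x \<longleftrightarrow> 0 < x" and flat_0_nonneg: "0 \<le> flat 0 x"
  by (auto simp: flat_0)

text \<open>
  An odd smooth version of the sign function, equal to it outside \<open>{-1<..<1}\<close>. The quotient
  is used instead of the integral of a bump function because monotonicity and the plateaus can
  then be read off.
\<close>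

definition step :: "real \<Rightarrow> real" where
  "step u = (flat 0 (1 + u) - flat 0 (1 - u)) / (flat 0 (1 + u) + flat 0 (1 - u))"

lemma step_denominator_pos: "0 < flat 0 (1 + u) + flat 0 (1 - u)"
proof (cases "0 < u")
  case True
  then have "0 < flat 0 (1 + u)" by (simp add: flat_0_pos_iff)
  then show ?thesis using flat_0_nonneg[of "1 - u"] by linarith
next
  case False
  then have "0 < flat 0 (1 - u)" by (simp add: flat_0_pos_iff)
  then show ?thesis using flat_0_nonneg[of "1 + u"] by linarith
qed

lemma step_minus: "step (- u) = - step u"
  using step_denominator_pos[of u] by (simp add: step_def field_simps)

lemma step_mono: "mono step"
proof (rule monoI)
  fix u v :: real
  assume "u \<le> v"
  then have "flat 0 (1 + u) * flat 0 (1 - v) \<le> flat 0 (1 + v) * flat 0 (1 - u)"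
    by (intro mult_mono flat_0_mono flat_0_nonneg) auto
  then show "step u \<le> step v"
    using step_denominator_pos[of u] step_denominator_pos[of v]
    by (simp add: step_def divide_simps) (simp add: algebra_simps)
qed

lemma step_eq_1: "1 \<le> u \<Longrightarrow> step u = 1"
  by (simp add: step_def flat_0)

lemma step_less_1: "u < 1 \<Longrightarrow> step u < 1"
  using step_denominator_pos[of u] flat_0_pos_iff[of "1 - u"]
  by (simp add: step_def divide_simps)

lemma abs_step_le_1: "\<bar>step u\<bar> \<le> 1"
  using step_denominator_pos[of u] flat_0_nonneg[of "1 + u"] flat_0_nonneg[of "1 - u"]
  by (simp add: step_def abs_le_iff divide_simps)

lemma C_k_on_step: "C_k_on k step UNIV"
proof (rule C_k_on_cong)
  have lin: "C_k_on k (\<lambda>u::real. 1 + c * u) UNIV" for c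
    by (intro C_k_on_add C_k_on_const C_k_on_cmult C_k_on_bounded_linear bounded_linear_ident open_UNIV)
  have f: "C_k_on k (\<lambda>u. flat 0 (1 + c * u)) UNIV" for c
    by (rule C_k_on_compose[OF open_UNIV lin C_k_on_flat]) simp
  have p: "C_k_on k (\<lambda>u. flat 0 (1 + 1 * u) + flat 0 (1 + (-1) * u)) UNIV"
    by (intro C_k_on_add f open_UNIV)
  show "C_k_on k (\<lambda>u. (flat 0 (1 + 1 * u) - flat 0 (1 + (-1) * u)) *
      (flat 0 (1 + 1 * u) + flat 0 (1 + (-1) * u)) powr (-1)) UNIV"
    by (intro C_k_on_mult C_k_on_diff f open_UNIV C_k_on_compose[OF open_UNIV p C_k_on_powr])
       (use step_denominator_pos in auto)
qed (use step_denominator_pos in \<open>auto simp: step_def powr_minus_divide less_imp_le\<close>)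

text \<open>
  The antiderivative of \<open>step\<close> through \<open>(1, 1)\<close>. It is convex since \<open>step\<close> is monotone, and the
  chosen value at \<open>1\<close> makes it agree with the absolute value outside \<open>{-1<..<1}\<close>.
\<close>

definition smooth_abs :: "real \<Rightarrow> real" where
  "smooth_abs = (SOME F. F 1 = 1 \<and> (\<forall>u. (F has_real_derivative step u) (at u)))"

lemma smooth_abs_1: "smooth_abs 1 = 1"
  and smooth_abs_has_derivative: "(smooth_abs has_real_derivative step u) (at u)"
proof -
  have "isCont step u" for u
    using C_k_on_step[of 0] by (simp add: continuous_on_eq_continuous_at)
  then obtain F where F: "\<And>u. (F has_real_derivative step u) (at u)"
    using einterval_antiderivative[of "-\<infinity>" "\<infinity>" step]
    by (auto simp: has_real_derivative_iff_has_vector_derivative)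
  have "\<exists>F. F 1 = 1 \<and> (\<forall>u. (F has_real_derivative step u) (at u))"
    by (rule exI[of _ "\<lambda>u. F u + (1 - F 1)"]) (auto intro!: derivative_eq_intros F)
  from someI_ex[OF this] show "smooth_abs 1 = 1" "(smooth_abs has_real_derivative step u) (at u)"
    unfolding smooth_abs_def by blast+
qed

lemma C_k_on_smooth_abs: "C_k_on k smooth_abs UNIV"
  by (rule C_k_on_pred[OF C_k_on_real_deriv[OF open_UNIV smooth_abs_has_derivative C_k_on_step]])

lemma smooth_abs_above_tangent: "smooth_abs u + step u * (v - u) \<le> smooth_abs v"
proof -
  have "convex_on UNIV smooth_abs"
    by (rule convex_on_realI[OF _ smooth_abs_has_derivative]) (use step_mono in \<open>auto dest: monoD\<close>)
  then have "step u * (v - u) \<le> smooth_abs v - smooth_abs u"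
    by (rule convex_on_imp_above_tangent) (use smooth_abs_has_derivative in auto)
  then show ?thesis by simp
qed

lemma smooth_abs_minus: "smooth_abs (- u) = smooth_abs u"
proof -
  have "((\<lambda>u. smooth_abs (- u) - smooth_abs u) has_real_derivative 0) (at x)" for x
    by (auto intro!: derivative_eq_intros DERIV_chain2[OF smooth_abs_has_derivative]
        smooth_abs_has_derivative simp: step_minus)
  then have "smooth_abs (- u) - smooth_abs u = smooth_abs (- 0) - smooth_abs 0"
    by (intro DERIV_isconst_all) auto
  then show ?thesis by simp
qed

text \<open>
  The two halves of the absolute value are tangents of the convex function \<open>smooth_abs\<close>, at \<open>1\<close> and
  at \<open>-1\<close>.
\<close>

lemma abs_le_smooth_abs: "\<bar>u\<bar> \<le> smooth_abs u"
  using smooth_abs_above_tangent[of 1 u] smooth_abs_above_tangent[of 1 "- u"]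
  by (simp add: step_eq_1 smooth_abs_1 smooth_abs_minus)

lemma smooth_abs_eq_abs:
  assumes "1 \<le> \<bar>u\<bar>"
  shows "smooth_abs u = \<bar>u\<bar>"
proof -
  have "smooth_abs \<bar>u\<bar> \<le> \<bar>u\<bar>"
    using smooth_abs_above_tangent[of "\<bar>u\<bar>" 1] assms by (simp add: step_eq_1 smooth_abs_1)
  moreover have "smooth_abs \<bar>u\<bar> = smooth_abs u"
    by (simp add: abs_if smooth_abs_minus)
  ultimately show ?thesis using abs_le_smooth_abs[of u] by simp
qed

lemma smooth_abs_pos: "0 < smooth_abs u"
proof (cases "u = 0")
  case True
  have "1/2 - step (1/2) / 2 \<le> smooth_abs 0"
    using smooth_abs_above_tangent[of "1/2" 0] abs_le_smooth_abs[of "1/2"] by simp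
  then show ?thesis using step_less_1[of "1/2"] True by simp
next
  case False
  then show ?thesis using abs_le_smooth_abs[of u] by linarith
qed

section \<open>A smooth norm whose unit sphere has a flat cap\<close>

definition axis_dist :: "real^3 \<Rightarrow> real" where
  "axis_dist x = sqrt ((x $ 1)\<^sup>2 + (x $ 2)\<^sup>2)"

text \<open>
  The perspective \<open>r * \<phi> (z / r)\<close> of the convex function \<open>\<phi> = smooth_abs\<close>, in cylindrical coordinates,
  extended by its limit to \<open>r = 0\<close>. As \<open>\<phi>\<close> is the absolute value outside \<open>{-1<..<1}\<close>, the norm is
  \<open>\<bar>z\<bar>\<close> on the double cone \<open>r \<le> \<bar>z\<bar>\<close>, and so the unit sphere contains a disc of the plane \<open>z = 1\<close>.
\<close>

definition capped_norm :: "real^3 \<Rightarrow> real" where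
  "capped_norm x = (if axis_dist x = 0 then \<bar>x $ 3\<bar> else axis_dist x * smooth_abs (x $ 3 / axis_dist x))"

lemma axis_dist_nonneg: "0 \<le> axis_dist x"
  by (simp add: axis_dist_def)

lemma axis_dist_scaleR: "axis_dist (c *\<^sub>R x) = \<bar>c\<bar> * axis_dist x"
proof -
  have "axis_dist (c *\<^sub>R x) = sqrt (c\<^sup>2 * ((x $ 1)\<^sup>2 + (x $ 2)\<^sup>2))"
    by (simp add: axis_dist_def algebra_simps power_mult_distrib)
  then show ?thesis by (simp add: axis_dist_def real_sqrt_mult)
qed

lemma axis_dist_triangle: "axis_dist (x + y) \<le> axis_dist x + axis_dist y"
  by (simp add: axis_dist_def real_sqrt_sum_squares_triangle_ineq)

lemma abs_le_capped_norm: "\<bar>x $ 3\<bar> \<le> capped_norm x"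
proof (cases "axis_dist x = 0")
  case False
  then have "0 < axis_dist x" using axis_dist_nonneg[of x] by simp
  then show ?thesis
    using abs_le_smooth_abs[of "x $ 3 / axis_dist x"] by (simp add: capped_norm_def field_simps)
qed (simp add: capped_norm_def)

lemma capped_norm_cap:
  assumes "axis_dist x \<le> \<bar>x $ 3\<bar>"
  shows "capped_norm x = \<bar>x $ 3\<bar>"
proof (cases "axis_dist x = 0")
  case False
  then have "0 < axis_dist x" using axis_dist_nonneg[of x] by simp
  then show ?thesis
    using assms smooth_abs_eq_abs[of "x $ 3 / axis_dist x"] by (simp add: capped_norm_def)
qed (simp add: capped_norm_def)

text \<open>
  The tangent of \<open>smooth_abs\<close> at \<open>u\<close>, made homogeneous. Equality holds where \<open>z / r = u\<close>, so the norm is a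
  supremum of functions that are linear in \<open>r\<close> and \<open>z\<close>; this is where the triangle inequality
  comes from.
\<close>

lemma capped_norm_supporting:
  "(smooth_abs u - u * step u) * axis_dist x + step u * x $ 3 \<le> capped_norm x"
proof (cases "axis_dist x = 0")
  case True
  have "step u * x $ 3 \<le> \<bar>step u\<bar> * \<bar>x $ 3\<bar>"
    by (metis abs_ge_self abs_mult)
  also have "\<dots> \<le> 1 * \<bar>x $ 3\<bar>"
    by (intro mult_right_mono abs_step_le_1) simp
  finally show ?thesis using True by (simp add: capped_norm_def)
next
  case False
  then have "0 < axis_dist x" using axis_dist_nonneg[of x] by simp
  then have "axis_dist x * (smooth_abs u + step u * (x $ 3 / axis_dist x - u)) \<le> capped_norm x"
    using smooth_abs_above_tangent[of u "x $ 3 / axis_dist x"] by (simp add: capped_norm_def)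
  then show ?thesis using \<open>0 < axis_dist x\<close> by (simp add: algebra_simps)
qed

text \<open>
  The coefficient of \<open>r\<close> above must be nonnegative, because \<open>r\<close> itself is only subadditive.
\<close>

lemma smooth_abs_intercept_nonneg: "0 \<le> smooth_abs u - u * step u"
proof -
  have "u * step u \<le> \<bar>u\<bar> * \<bar>step u\<bar>"
    by (metis abs_ge_self abs_mult)
  also have "\<dots> \<le> \<bar>u\<bar> * 1"
    by (intro mult_left_mono abs_step_le_1) simp
  finally show ?thesis using abs_le_smooth_abs[of u] by simp
qed

lemma capped_norm_triangle: "capped_norm (x + y) \<le> capped_norm x + capped_norm y"
proof (cases "axis_dist (x + y) = 0")
  case True
  then have "capped_norm (x + y) = \<bar>x $ 3 + y $ 3\<bar>"
    by (simp add: capped_norm_def)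
  then show ?thesis
    using abs_le_capped_norm[of x] abs_le_capped_norm[of y] by linarith
next
  case False
  \<comment> \<open>the tangent that is active at \<open>x + y\<close>\<close>
  define u where "u = (x + y) $ 3 / axis_dist (x + y)"
  define a where "a = smooth_abs u - u * step u"
  have "capped_norm (x + y) = a * axis_dist (x + y) + step u * (x + y) $ 3"
    using False by (simp add: capped_norm_def a_def u_def field_simps)
  also have "\<dots> \<le> a * (axis_dist x + axis_dist y) + step u * (x + y) $ 3"
    using axis_dist_triangle smooth_abs_intercept_nonneg
    by (intro add_right_mono mult_left_mono) (auto simp: a_def)
  also have "\<dots> = (a * axis_dist x + step u * x $ 3) + (a * axis_dist y + step u * y $ 3)"
    by (simp add: algebra_simps)
  also have "\<dots> \<le> capped_norm x + capped_norm y"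
    unfolding a_def by (intro add_mono capped_norm_supporting)
  finally show ?thesis .
qed

lemma is_norm_capped_norm: "is_norm capped_norm"
  unfolding is_norm_def
proof (intro conjI allI)
  fix x y :: "real^3" and c :: real
  show "0 \<le> capped_norm x"
    using abs_le_capped_norm[of x] by linarith
  show "capped_norm x = 0 \<longleftrightarrow> x = 0"
  proof
    assume "capped_norm x = 0"
    moreover from this have "axis_dist x = 0"
      using smooth_abs_pos[of "x $ 3 / axis_dist x"] by (auto simp: capped_norm_def split: if_splits)
    ultimately show "x = 0"
      by (simp add: capped_norm_def axis_dist_def sum_power2_eq_zero_iff vec_eq_iff forall_3)
  qed (simp add: capped_norm_def axis_dist_def)
  show "capped_norm (c *\<^sub>R x) = \<bar>c\<bar> * capped_norm x"
  proof (cases "c = 0 \<or> axis_dist x = 0")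
    case False
    have "smooth_abs (c * x $ 3 / (\<bar>c\<bar> * axis_dist x)) = smooth_abs (x $ 3 / axis_dist x)"
      using False smooth_abs_minus[of "x $ 3 / axis_dist x"] by (cases "0 < c") (auto simp: abs_if)
    then show ?thesis using False by (simp add: capped_norm_def axis_dist_scaleR)
  qed (auto simp: capped_norm_def axis_dist_scaleR abs_mult)
  show "capped_norm (x + y) \<le> capped_norm x + capped_norm y"
    by (rule capped_norm_triangle)
qed

lemma C_k_on_nth: "open S \<Longrightarrow> C_k_on k (\<lambda>x::real^3. x $ i) S"
  by (rule C_k_on_bounded_linear) (rule bounded_linear_vec_nth)

lemma C_k_on_abs: "C_k_on k (abs :: real \<Rightarrow> real) ({0<..} \<union> {..<0})"
proof (rule C_k_on_Un)
  show "C_k_on k (abs :: real \<Rightarrow> real) {0<..}"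
    by (rule C_k_on_cong[OF _ C_k_on_bounded_linear[OF bounded_linear_ident]]) auto
  show "C_k_on k (abs :: real \<Rightarrow> real) {..<0}"
    by (rule C_k_on_cong[OF _ C_k_on_bounded_linear[OF bounded_linear_minus[OF bounded_linear_ident]]]) auto
qed auto

text \<open>
  Two open sets cover the complement of the origin: off the third axis the perspective formula
  is smooth, and inside the double cone the norm is \<open>\<bar>z\<bar>\<close> with \<open>z \<noteq> 0\<close>.
\<close>

lemma is_smooth_norm_capped_norm: "is_smooth_norm capped_norm"
  unfolding is_smooth_norm_def
proof (intro conjI allI is_norm_capped_norm)
  fix k
  let ?q = "\<lambda>x::real^3. x $ 1 * x $ 1 + x $ 2 * x $ 2"
  define S where "S = {x. 0 < ?q x}"
  define U where "U = {x::real^3. ?q x < x $ 3 * x $ 3}"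
  have S: "open S" and U: "open U"
    unfolding S_def U_def by (intro open_Collect_less continuous_intros)+
  have axis_dist: "axis_dist x = ?q x powr (1/2)" for x
    by (simp add: axis_dist_def powr_half_sqrt power2_eq_square)
  have "C_k_on k capped_norm S"
  proof (rule C_k_on_cong[OF S])
    have "C_k_on k ?q S"
      by (intro C_k_on_add C_k_on_mult C_k_on_nth S)
    then have q: "C_k_on k (\<lambda>x. ?q x powr a) S" for a
      by (rule C_k_on_compose[OF S _ C_k_on_powr]) (auto simp: S_def)
    show "C_k_on k (\<lambda>x. ?q x powr (1/2) * smooth_abs (x $ 3 * ?q x powr (-1/2))) S"
      by (intro C_k_on_mult C_k_on_compose[OF S _ C_k_on_smooth_abs] C_k_on_nth q S) auto
    show "?q x powr (1/2) * smooth_abs (x $ 3 * ?q x powr (-1/2)) = capped_norm x"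
      if "x \<in> S" for x
    proof -
      have "0 < ?q x"
        using that by (simp only: S_def mem_Collect_eq)
      then have "axis_dist x \<noteq> 0"
        unfolding axis_dist powr_eq_0_iff by (rule less_imp_neq[symmetric])
      moreover have "?q x powr (-1/2) = 1 / axis_dist x"
        by (simp add: axis_dist powr_minus_divide)
      ultimately show ?thesis by (simp only: capped_norm_def axis_dist[symmetric] if_False) simp
    qed
  qed
  moreover have "C_k_on k capped_norm U"
  proof (rule C_k_on_cong[OF U])
    have "x $ 3 \<noteq> 0" if "x \<in> U" for x
      using that by (auto simp: U_def not_sum_squares_lt_zero)
    then show "C_k_on k (\<lambda>x. \<bar>x $ 3\<bar>) U"
      by (intro C_k_on_compose[OF U _ C_k_on_abs] C_k_on_nth U) force
    show "\<bar>x $ 3\<bar> = capped_norm x" if "x \<in> U" for x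
    proof -
      have "axis_dist x \<le> sqrt ((x $ 3)\<^sup>2)"
        using that unfolding axis_dist_def by (intro real_sqrt_le_mono) (simp add: U_def power2_eq_square)
      then show ?thesis by (simp add: capped_norm_cap)
    qed
  qed
  ultimately have "C_k_on k capped_norm (S \<union> U)"
    by (rule C_k_on_Un[OF S U])
  also have "S \<union> U = UNIV - {0}"
  proof -
    have "x \<in> S \<union> U \<longleftrightarrow> x \<noteq> 0" for x
    proof (cases "x $ 1 = 0 \<and> x $ 2 = 0")
      case True
      then show ?thesis
        by (auto simp: S_def U_def vec_eq_iff forall_3 zero_less_mult_iff)
    next
      case False
      then have "x \<in> S" by (auto simp: S_def sum_squares_gt_zero_iff)
      then show ?thesis by (auto simp: S_def)
    qed
    then show ?thesis by auto
  qed
  finally show "C_k_on k capped_norm (UNIV - {0})" .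
qed

section \<open>A norm with a hexagonal plane section\<close>

text \<open>
  The supremum norm in the coordinates \<open>x + z\<close>, \<open>y + z\<close>, \<open>z - x - y\<close>. They add up to \<open>3 * z\<close>, so the
  planes of constant \<open>z\<close> are the planes of constant coordinate sum of the cube, whose central
  section is a regular hexagon.
\<close>

definition hex_norm :: "real^3 \<Rightarrow> real" where
  "hex_norm x = max \<bar>x $ 1 + x $ 3\<bar> (max \<bar>x $ 2 + x $ 3\<bar> \<bar>x $ 3 - x $ 1 - x $ 2\<bar>)"

lemma hex_norm_le_iff:
  "hex_norm x \<le> c \<longleftrightarrow>
    \<bar>x $ 1 + x $ 3\<bar> \<le> c \<and> \<bar>x $ 2 + x $ 3\<bar> \<le> c \<and> \<bar>x $ 3 - x $ 1 - x $ 2\<bar> \<le> c"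
  by (simp add: hex_norm_def)

lemma is_norm_hex_norm: "is_norm hex_norm"
  unfolding is_norm_def
proof (intro conjI allI)
  fix x y :: "real^3" and c :: real
  show "0 \<le> hex_norm x"
    by (auto simp: hex_norm_def)
  show "hex_norm x = 0 \<longleftrightarrow> x = 0"
  proof
    assume "hex_norm x = 0"
    then have "hex_norm x \<le> 0" by simp
    then show "x = 0"
      unfolding hex_norm_le_iff vec_eq_iff forall_3 zero_index by linarith
  qed (simp add: hex_norm_def)
  have "hex_norm (c *\<^sub>R x) = max (\<bar>c\<bar> * \<bar>x $ 1 + x $ 3\<bar>)
      (max (\<bar>c\<bar> * \<bar>x $ 2 + x $ 3\<bar>) (\<bar>c\<bar> * \<bar>x $ 3 - x $ 1 - x $ 2\<bar>))"
    by (simp add: hex_norm_def abs_mult[symmetric] algebra_simps)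
  also have "\<dots> = \<bar>c\<bar> * hex_norm x"
    by (simp add: hex_norm_def max_mult_distrib_left)
  finally show "hex_norm (c *\<^sub>R x) = \<bar>c\<bar> * hex_norm x" .
  show "hex_norm (x + y) \<le> hex_norm x + hex_norm y"
  proof -
    note x = hex_norm_le_iff[THEN iffD1, OF order_refl, of x]
    note y = hex_norm_le_iff[THEN iffD1, OF order_refl, of y]
    have "\<bar>(x + y) $ 1 + (x + y) $ 3\<bar> \<le> hex_norm x + hex_norm y"
      using x[THEN conjunct1] y[THEN conjunct1] by simp
    moreover have "\<bar>(x + y) $ 2 + (x + y) $ 3\<bar> \<le> hex_norm x + hex_norm y"
      using x[THEN conjunct2, THEN conjunct1] y[THEN conjunct2, THEN conjunct1] by simp
    moreover have "\<bar>(x + y) $ 3 - (x + y) $ 1 - (x + y) $ 2\<bar> \<le> hex_norm x + hex_norm y"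
      using x[THEN conjunct2, THEN conjunct2] y[THEN conjunct2, THEN conjunct2] by simp
    ultimately show ?thesis unfolding hex_norm_le_iff by blast
  qed
qed

lemma Lip_wrt_bound:
  assumes "is_norm N" "lipschitz_wrt N S f" "Lip_wrt N S f \<le> L" "x \<in> S" "y \<in> S"
  shows "N (f x - f y) \<le> L * N (x - y)"
proof (cases "x = y")
  case True
  then show ?thesis using assms(1) unfolding is_norm_def by (metis diff_self mult_zero_right order_refl)
next
  case False
  let ?A = "{N (f x - f y) / N (x - y) | x y. x \<in> S \<and> y \<in> S \<and> x \<noteq> y}"
  have pos: "0 < N (x - y)" if "x \<noteq> y" for x y
    using assms(1) that unfolding is_norm_def by (metis less_eq_real_def right_minus_eq)
  obtain L' where L': "\<And>x y. x \<in> S \<Longrightarrow> y \<in> S \<Longrightarrow> N (f x - f y) \<le> L' * N (x - y)"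
    using assms(2) by (auto simp: lipschitz_wrt_def)
  have "bdd_above ?A"
  proof (rule bdd_aboveI)
    show "r \<le> L'" if "r \<in> ?A" for r
      using that L' pos by (auto simp: divide_le_eq)
  qed
  moreover have "N (f x - f y) / N (x - y) \<in> ?A"
    using False assms(4,5) by blast
  ultimately have "N (f x - f y) / N (x - y) \<le> Lip_wrt N S f"
    unfolding Lip_wrt_def by (rule cSup_upper[rotated])
  then show ?thesis
    using assms(3) pos[OF False] by (simp add: divide_le_eq) (meson mult_right_mono order_trans less_imp_le)
qed

section \<open>The averaging argument\<close>

lemma telescoping_lower_bound:
  fixes f :: "nat \<Rightarrow> real"
  assumes "\<bar>f m - (u + m * s)\<bar> \<le> \<epsilon>" "\<bar>f 0 - u\<bar> \<le> \<epsilon>"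
  shows "m * s - 2 * \<epsilon> \<le> (\<Sum>i<m. f (Suc i) - f i)"
  using assms by (simp add: sum_lessThan_telescope)

text \<open>
  In the application \<open>a\<close>, \<open>b\<close>, \<open>c\<close> are the three coordinates of \<open>\<Psi>\<close> at the grid points
  \<open>(0, 0, 1) + t * (i * v1 + j * v2)\<close> with \<open>v1 = (4, -2, 0)\<close> and \<open>v2 = (-2, 4, 0)\<close>; the third direction is
  \<open>v3 = - v1 - v2\<close>. Moving by \<open>t * vk\<close> raises the \<open>k\<close>-th coordinate of the grid point by \<open>4 * t\<close>. A single
  increment of \<open>\<Psi>\<close> is not controlled by closeness to the identity, since \<open>\<epsilon>\<close> may be far larger than \<open>t\<close>,
  but along a line of the grid the increments telescope and the error \<open>\<epsilon>\<close> enters only at the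
  two ends. The diagonal steps in direction \<open>v3\<close> are split into steps along \<open>- v1\<close> and \<open>- v2\<close>, which
  is why indices up to \<open>Suc m\<close> occur.
\<close>

lemma grid_sum_bound:
  fixes a b c :: "nat \<Rightarrow> nat \<Rightarrow> real"
  assumes a: "\<And>i j. i \<le> Suc m \<Longrightarrow> j \<le> Suc m \<Longrightarrow> \<bar>a i j - (1 + t * (4 * real i - 2 * real j))\<bar> \<le> \<epsilon>"
    and b: "\<And>i j. i \<le> Suc m \<Longrightarrow> j \<le> Suc m \<Longrightarrow> \<bar>b i j - (1 + t * (4 * real j - 2 * real i))\<bar> \<le> \<epsilon>"
    and c: "\<And>i j. i \<le> Suc m \<Longrightarrow> j \<le> Suc m \<Longrightarrow> \<bar>c i j - (1 - t * (2 * real i + 2 * real j))\<bar> \<le> \<epsilon>"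
    and cell: "\<And>i j. i < m \<Longrightarrow> j < m \<Longrightarrow>
      (a (Suc i) (Suc j) - a i (Suc j)) + (b (Suc i) (Suc j) - b (Suc i) j)
        + (c (Suc i) (Suc j) - c (Suc (Suc i)) (Suc (Suc j))) \<le> K"
  shows "m * (12 * m * t - 8 * \<epsilon>) \<le> m * (m * K)"
proof -
  have A: "m * (m * (4 * t) - 2 * \<epsilon>) \<le> (\<Sum>j<m. \<Sum>i<m. a (Suc i) (Suc j) - a i (Suc j))"
  proof -
    have "m * (4 * t) - 2 * \<epsilon> \<le> (\<Sum>i<m. a (Suc i) (Suc j) - a i (Suc j))" if "j < m" for j
      by (rule telescoping_lower_bound[where u = "1 + t * (0 - 2 * real (Suc j))"])
         (use a[of m "Suc j"] a[of 0 "Suc j"] that in \<open>simp_all add: algebra_simps\<close>)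
    then show ?thesis
      using sum_bounded_below[of "{..<m}" "m * (4 * t) - 2 * \<epsilon>"] by simp
  qed
  have B: "m * (m * (4 * t) - 2 * \<epsilon>) \<le> (\<Sum>i<m. \<Sum>j<m. b (Suc i) (Suc j) - b (Suc i) j)"
  proof -
    have "m * (4 * t) - 2 * \<epsilon> \<le> (\<Sum>j<m. b (Suc i) (Suc j) - b (Suc i) j)" if "i < m" for i
      by (rule telescoping_lower_bound[where u = "1 + t * (0 - 2 * real (Suc i))"])
         (use b[of "Suc i" m] b[of "Suc i" 0] that in \<open>simp_all add: algebra_simps\<close>)
    then show ?thesis
      using sum_bounded_below[of "{..<m}" "m * (4 * t) - 2 * \<epsilon>"] by simp
  qed
  have C1: "m * (m * (2 * t) - 2 * \<epsilon>)
      \<le> (\<Sum>j<m. \<Sum>i<m. - c (Suc (Suc i)) (Suc j) - - c (Suc i) (Suc j))"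
  proof -
    have "m * (2 * t) - 2 * \<epsilon> \<le> (\<Sum>i<m. - c (Suc (Suc i)) (Suc j) - - c (Suc i) (Suc j))"
      if "j < m" for j
      by (rule telescoping_lower_bound[where u = "- 1 + t * (2 * Suc j + 2)"])
         (use c[of "Suc m" "Suc j"] c[of "Suc 0" "Suc j"] that in \<open>simp_all add: algebra_simps abs_le_iff\<close>)
    then show ?thesis
      using sum_bounded_below[of "{..<m}" "m * (2 * t) - 2 * \<epsilon>"] by simp
  qed
  have C2: "m * (m * (2 * t) - 2 * \<epsilon>)
      \<le> (\<Sum>i<m. \<Sum>j<m. - c (Suc (Suc i)) (Suc (Suc j)) - - c (Suc (Suc i)) (Suc j))"
  proof -
    have "m * (2 * t) - 2 * \<epsilon>
        \<le> (\<Sum>j<m. - c (Suc (Suc i)) (Suc (Suc j)) - - c (Suc (Suc i)) (Suc j))"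
      if "i < m" for i
      by (rule telescoping_lower_bound[where u = "- 1 + t * (2 * Suc (Suc i) + 2)"])
         (use c[of "Suc (Suc i)" "Suc m"] c[of "Suc (Suc i)" "Suc 0"] that in \<open>simp_all add: algebra_simps abs_le_iff\<close>)
    then show ?thesis
      using sum_bounded_below[of "{..<m}" "m * (2 * t) - 2 * \<epsilon>"] by simp
  qed
  have "m * (12 * m * t - 8 * \<epsilon>) = 2 * (m * (m * (4 * t) - 2 * \<epsilon>)) + 2 * (m * (m * (2 * t) - 2 * \<epsilon>))"
    by (simp add: algebra_simps)
  also have "\<dots> \<le> (\<Sum>i<m. \<Sum>j<m. a (Suc i) (Suc j) - a i (Suc j))
        + (\<Sum>i<m. \<Sum>j<m. b (Suc i) (Suc j) - b (Suc i) j)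
        + ((\<Sum>i<m. \<Sum>j<m. - c (Suc (Suc i)) (Suc j) - - c (Suc i) (Suc j))
        + (\<Sum>i<m. \<Sum>j<m. - c (Suc (Suc i)) (Suc (Suc j)) - - c (Suc (Suc i)) (Suc j)))"
    using A B C1 C2
      sum.swap[of "\<lambda>i j. a (Suc i) (Suc j) - a i (Suc j)" "{..<m}" "{..<m}"]
      sum.swap[of "\<lambda>i j. - c (Suc (Suc i)) (Suc j) - - c (Suc i) (Suc j)" "{..<m}" "{..<m}"]
    by linarith
  also have "\<dots> = (\<Sum>i<m. \<Sum>j<m.
      (a (Suc i) (Suc j) - a i (Suc j)) + (b (Suc i) (Suc j) - b (Suc i) j)
        + (c (Suc i) (Suc j) - c (Suc (Suc i)) (Suc (Suc j))))"
    unfolding sum.distrib[symmetric] by (intro sum.cong refl) simp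
  also have "\<dots> \<le> (\<Sum>i<m. \<Sum>j<m. K)"
    by (intro sum_mono cell) auto
  finally show ?thesis by simp
qed

text \<open>
  Points of the sphere close to the middle of the flat cap lie on the cap: this confines the
  values of \<open>\<Psi>\<close> near the centre of the cap to a plane.
\<close>

lemma near_cap:
  assumes "\<bar>x $ 1\<bar> \<le> 1/4" "\<bar>x $ 2\<bar> \<le> 1/4" "31/32 \<le> x $ 3"
    and "capped_norm y = 1" "hex_norm (y - x) \<le> 1/100"
  shows "y $ 3 = 1"
proof -
  have "\<bar>y $ 1\<bar> + \<bar>y $ 2\<bar> \<le> 3/4 \<and> 3/4 \<le> y $ 3"
    using assms(1-3,5) unfolding hex_norm_le_iff vector_minus_component by argo
  moreover have "axis_dist y \<le> \<bar>y $ 1\<bar> + \<bar>y $ 2\<bar>"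
    unfolding axis_dist_def by (rule sqrt_sum_squares_le_sum_abs)
  ultimately show ?thesis
    using assms(4) capped_norm_cap[of y] by linarith
qed

lemma cap_subset_sphere:
  assumes "\<bar>x $ 1\<bar> \<le> 1/4" "\<bar>x $ 2\<bar> \<le> 1/4" "x $ 3 = 1"
  shows "capped_norm x = 1"
proof -
  have "axis_dist x \<le> \<bar>x $ 1\<bar> + \<bar>x $ 2\<bar>"
    unfolding axis_dist_def by (rule sqrt_sum_squares_le_sum_abs)
  then show ?thesis using assms capped_norm_cap[of x] by simp
qed

text \<open>
  The average of \<open>\<Psi>\<close> over the layer \<open>z = 1 - t\<close> of the grid is compared with the average over
  the layer \<open>z = 1\<close>. With \<open>e3 = (0, 0, 1)\<close>, each vector \<open>vk - e3\<close> has norm \<open>3\<close>, so the Lipschitz bound allows the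
  \<open>k\<close>-th coordinate of \<open>\<Psi>\<close> to grow by at most about \<open>3 * t\<close> on the way from \<open>q - t * vk\<close> to \<open>q - t * e3\<close>, where
  \<open>q\<close> is a grid point. On average it grows by about \<open>4 * t\<close> from \<open>q - t * vk\<close> to \<open>q\<close>. Hence each of the three
  coordinates drops on average by at least about \<open>t\<close> from \<open>q\<close> to \<open>q - t * e3\<close>, whereas their sum is \<open>3\<close> at both
  points because \<open>\<Psi>\<close> takes values in the plane \<open>z = 1\<close>. The length \<open>m * t\<close> of the grid stays fixed
  while \<open>t\<close> is taken small enough for the lower layer to lie in the domain of \<open>\<Psi>\<close>.
\<close>

lemma no_almost_nonexpansive_retraction:
  fixes \<Psi> :: "real^3 \<Rightarrow> real^3"
  assumes M: "{x. capped_norm x = 1} \<subseteq> interior Mh"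
    and range: "\<And>x. x \<in> Mh \<Longrightarrow> capped_norm (\<Psi> x) = 1"
    and lip: "\<And>x y. x \<in> Mh \<Longrightarrow> y \<in> Mh \<Longrightarrow> hex_norm (\<Psi> x - \<Psi> y) \<le> (1 + 1/100) * hex_norm (x - y)"
    and close: "\<And>x. x \<in> Mh \<Longrightarrow> hex_norm (\<Psi> x - x) \<le> 1/100"
  shows False
proof -
  define K :: "(real^3) set" where "K = cbox (vector [-1/4, -1/4, 1]) (vector [1/4, 1/4, 1])"
  have K: "x \<in> K \<longleftrightarrow> \<bar>x $ 1\<bar> \<le> 1/4 \<and> \<bar>x $ 2\<bar> \<le> 1/4 \<and> x $ 3 = 1" for x
    by (auto simp: K_def mem_box_cart forall_3)
  have "K \<subseteq> interior Mh"
    using M cap_subset_sphere by (auto simp: K)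
  then obtain e where "e > 0" and e: "(\<Union>x\<in>K. ball x e) \<subseteq> interior Mh"
    using compact_subset_open_imp_ball_epsilon_subset[of K "interior Mh"] by (auto simp: K_def)
  obtain n where n: "inverse (Suc n) < e"
    using reals_Archimedean[OF \<open>e > 0\<close>] by blast
  \<comment> \<open>the grid has the fixed size \<open>m * t = 1/32\<close>, which keeps it inside \<open>K\<close>\<close>
  define m where "m = Suc n"
  define t where "t = 1 / (32 * real m)"
  have m: "0 < real m" and mt: "m * t = 1/32" and "0 < t" and t32: "t \<le> 1/32" and "t < e"
    using n by (auto simp: m_def t_def field_simps)
  define p where "p i j s = (vector [t * (4 * real i - 2 * real j), t * (4 * real j - 2 * real i), s] :: real^3)"
    for i j :: nat and s
  have p [simp]: "p i j s $ 1 = t * (4 * real i - 2 * real j)" "p i j s $ 2 = t * (4 * real j - 2 * real i)"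
    "p i j s $ 3 = s" for i j s
    by (simp_all add: p_def)
  have small: "\<bar>t * (4 * real i - 2 * real j)\<bar> \<le> 1/4" if "i \<le> Suc m" "j \<le> Suc m" for i j
  proof -
    have "t * real i \<le> 1/16" if "i \<le> Suc m" for i
    proof -
      have "real i \<le> 2 * real m" using that by (simp add: m_def)
      then have "t * real i \<le> t * (2 * real m)" using \<open>0 < t\<close> by simp
      then show ?thesis using mt by (simp add: algebra_simps)
    qed
    from this[of i] this[of j] that have "t * real i \<le> 1/16" "t * real j \<le> 1/16"
      by auto
    moreover have "0 \<le> t * real i" "0 \<le> t * real j"
      using \<open>0 < t\<close> by simp_all
    ultimately have "\<bar>4 * (t * real i) - 2 * (t * real j)\<bar> \<le> 1/4"
      by linarith
    then show ?thesis by (simp add: algebra_simps)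
  qed
  have inK: "p i j 1 \<in> K" if "i \<le> Suc m" "j \<le> Suc m" for i j
    using small[OF that] small[OF that(2,1)] by (simp add: K)
  have in1: "p i j 1 \<in> Mh" if "i \<le> Suc m" "j \<le> Suc m" for i j
    using inK[OF that] \<open>K \<subseteq> interior Mh\<close> interior_subset by blast
  have in2: "p i j (1 - t) \<in> Mh" if "i \<le> Suc m" "j \<le> Suc m" for i j
  proof -
    have "p i j 1 - p i j (1 - t) = t *\<^sub>R axis 3 1"
      by (simp add: vec_eq_iff forall_3 axis_def)
    then have "dist (p i j 1) (p i j (1 - t)) < e"
      using \<open>t < e\<close> \<open>0 < t\<close> by (simp add: dist_norm norm_axis_1)
    then show ?thesis
      using inK[OF that] e interior_subset by (meson UN_I mem_ball subsetD)
  qed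
  have third: "\<Psi> (p i j s) $ 3 = 1" if "i \<le> Suc m" "j \<le> Suc m" "s = 1 \<or> s = 1 - t" for i j s
  proof (rule near_cap[OF _ _ _ range close])
    show "p i j s \<in> Mh" using in1 in2 that by auto
    show "p i j s \<in> Mh" using in1 in2 that by auto
  qed (use that small t32 in auto)
  define a where "a i j = \<Psi> (p i j 1) $ 1 + \<Psi> (p i j 1) $ 3" for i j
  define b where "b i j = \<Psi> (p i j 1) $ 2 + \<Psi> (p i j 1) $ 3" for i j
  define c where "c i j = \<Psi> (p i j 1) $ 3 - \<Psi> (p i j 1) $ 1 - \<Psi> (p i j 1) $ 2" for i j
  have "m * (12 * m * t - 8 * (1/100)) \<le> m * (m * (9 * (1 + 1/100) * t))"
  proof (rule grid_sum_bound)
    fix i j assume ij: "i \<le> Suc m" "j \<le> Suc m"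
    note close[OF in1[OF ij], unfolded hex_norm_le_iff vector_minus_component p]
    then show "\<bar>a i j - (1 + t * (4 * real i - 2 * real j))\<bar> \<le> 1/100"
      "\<bar>b i j - (1 + t * (4 * real j - 2 * real i))\<bar> \<le> 1/100"
      "\<bar>c i j - (1 - t * (2 * real i + 2 * real j))\<bar> \<le> 1/100"
      by (simp_all add: a_def b_def c_def algebra_simps)
  next
    fix i j assume ij: "i < m" "j < m"
    \<comment> \<open>the three grid points are \<open>q - t * vk\<close>, where \<open>q\<close> lies above \<open>?q\<close>\<close>
    let ?q = "p (Suc i) (Suc j) (1 - t)"
    have 3: "hex_norm (\<Psi> ?q - \<Psi> (p i' j' 1)) \<le> (1 + 1/100) * (3 * t)"
      if "(i', j') \<in> {(i, Suc j), (Suc i, j), (Suc (Suc i), Suc (Suc j))}" for i' j'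
    proof -
      have "hex_norm (?q - p i' j' 1) \<le> 3 * t"
        unfolding hex_norm_le_iff vector_minus_component p
        using that \<open>0 < t\<close> by (auto simp: algebra_simps)
      then have "(1 + 1/100) * hex_norm (?q - p i' j' 1) \<le> (1 + 1/100) * (3 * t)"
        by (rule mult_left_mono) simp
      moreover have "hex_norm (\<Psi> ?q - \<Psi> (p i' j' 1)) \<le> (1 + 1/100) * hex_norm (?q - p i' j' 1)"
        by (rule lip[OF in2 in1]) (use that ij in auto)
      ultimately show ?thesis by (rule order_trans[rotated])
    qed
    have s: "\<Psi> ?q $ 3 = 1" "\<Psi> (p (Suc i) (Suc j) 1) $ 3 = 1"
      using ij by (auto intro: third)
    show "(a (Suc i) (Suc j) - a i (Suc j)) + (b (Suc i) (Suc j) - b (Suc i) j)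
        + (c (Suc i) (Suc j) - c (Suc (Suc i)) (Suc (Suc j))) \<le> 9 * (1 + 1/100) * t"
    proof -
      note 3 = 3[unfolded hex_norm_le_iff vector_minus_component]
      have "\<Psi> ?q $ 1 + 1 - a i (Suc j) \<le> (1 + 1/100) * (3 * t)"
        using abs_le_D1[OF 3[of i "Suc j", THEN conjunct1]] s(1) by (simp add: a_def)
      moreover have "\<Psi> ?q $ 2 + 1 - b (Suc i) j \<le> (1 + 1/100) * (3 * t)"
        using abs_le_D1[OF 3[of "Suc i" j, THEN conjunct2, THEN conjunct1]] s(1) by (simp add: b_def)
      moreover have "1 - \<Psi> ?q $ 1 - \<Psi> ?q $ 2 - c (Suc (Suc i)) (Suc (Suc j)) \<le> (1 + 1/100) * (3 * t)"
        using abs_le_D1[OF 3[of "Suc (Suc i)" "Suc (Suc j)", THEN conjunct2, THEN conjunct2]] s(1)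
        by (simp add: c_def)
      moreover have "a (Suc i) (Suc j) + b (Suc i) (Suc j) + c (Suc i) (Suc j) = 3"
        using s by (simp add: a_def b_def c_def)
      ultimately show ?thesis by (simp add: algebra_simps)
    qed
  qed
  \<comment> \<open>for \<open>m * t = 1/32\<close> this reads \<open>12/32 - 8/100 \<le> 9.09/32\<close>, which is false\<close>
  then have "12 * (m * t) - 8/100 \<le> 9 * (1 + 1/100) * (m * t)"
    using m by (simp add: algebra_simps)
  then show False unfolding mt by simp
qed

theorem mainTheorem2:
  shows "\<exists>(N :: real^3 \<Rightarrow> real) (T :: real^3 \<Rightarrow> real).
    is_smooth_norm N \<and> is_norm T \<and>
    (let M = {x. N x = 1} in
      \<not> (\<forall>\<xi>>0. \<exists>Mh \<Psi>.
            M \<subseteq> interior Mh \<and>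
            \<Psi> ` Mh \<subseteq> M \<and>
            lipschitz_wrt T Mh \<Psi> \<and>
            Lip_wrt T Mh \<Psi> \<le> 1 + \<xi> \<and>
            (\<forall>x\<in>Mh. T (\<Psi> x - x) \<le> \<xi>)))"
  unfolding Let_def
proof (rule exI[of _ capped_norm], rule exI[of _ hex_norm],
    intro conjI notI is_smooth_norm_capped_norm is_norm_hex_norm)
  let ?M = "{x. capped_norm x = 1}"
  assume "\<forall>\<xi>>0. \<exists>Mh \<Psi>. ?M \<subseteq> interior Mh \<and> \<Psi> ` Mh \<subseteq> ?M \<and> lipschitz_wrt hex_norm Mh \<Psi> \<and>
      Lip_wrt hex_norm Mh \<Psi> \<le> 1 + \<xi> \<and> (\<forall>x\<in>Mh. hex_norm (\<Psi> x - x) \<le> \<xi>)"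
  from this[rule_format, of "1/100"] obtain Mh \<Psi> where
    *: "?M \<subseteq> interior Mh" "\<Psi> ` Mh \<subseteq> ?M" "lipschitz_wrt hex_norm Mh \<Psi>"
      "Lip_wrt hex_norm Mh \<Psi> \<le> 1 + 1/100" "\<forall>x\<in>Mh. hex_norm (\<Psi> x - x) \<le> 1/100"
    by auto
  show False
    by (rule no_almost_nonexpansive_retraction[OF *(1) _ Lip_wrt_bound[OF is_norm_hex_norm *(3,4)]])
       (use * in auto)
qed

end
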